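(* The auxiliary quantities $r_n(t)$ and $R_n(t)$ satisfy the coupled Riccati equations $$r_n'(t)=\frac{r_n^2(t)-\gamma r_n(t)}{R_n(t)}-\frac{(r_n(t)+n)R_n(t)}{2},$$ $$R_n'(t)=2r_n(t)-\frac12\,(t-R_n(t))R_n(t)-\gamma ,$$ where $'$ denotes $d/dt$.
   Context: Let $A\ge 0$, $A+B\ge 0$, $\gamma>-1$. For $t\in\mathbb{R}$ let $w(z)=w(z,t,\gamma)=e^{-z^2+tz}|z-t|^{\gamma}(A+B\theta(z-t))$ for $z\in\mathbb{R}$, where $\theta(x)=1$ for $x>0$ and $\theta(x)=0$ for $x\le 0$. Let $P_n(z)=P_n(z,t,\gamma)$ be the monic polynomials of degree $n$ orthogonal with respect to $w$: $\int_{\mathbb{R}}P_jP_i\,w\,dz=h_j\delta_{ij}$, with $h_n=h_n(t)$. Define $$R_n(t)=\frac{\gamma}{h_n}\int_{\mathbb{R}}\frac{P_n^2(y)w(y)}{y-t}\,dy,\qquad r_n(t)=\frac{\gamma}{h_{n-1}}\int_{\mathbb{R}}\frac{P_n(y)P_{n-1}(y)w(y)}{y-t}\,dy.$$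
   Formalization: For -1<γ≤0 the integrals defining R_n, r_n generally diverge and are read as Hadamard finite parts (value B·f(t) at γ=0); A=B=0 is excluded, the equation for r_n' is asserted where R_n(t)≠0, and r_0=0. *)

theory Defs
  imports "HOL-Analysis.Analysis" "HOL-Computational_Algebra.Polynomial"
begin

definition step :: "real \<Rightarrow> real" where
  "step x = (if x > 0 then 1 else 0)"

definition weight :: "real \<Rightarrow> real \<Rightarrow> real \<Rightarrow> real \<Rightarrow> real \<Rightarrow> real" where
  "weight A B \<gamma> t z = exp (- (z\<^sup>2) + t * z) * \<bar>z - t\<bar> powr \<gamma> * (A + B * step (z - t))"

definition monic_orthogonal :: "(real \<Rightarrow> real) \<Rightarrow> (nat \<Rightarrow> real poly) \<Rightarrow> (nat \<Rightarrow> real) \<Rightarrow> bool" where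
  "monic_orthogonal w P h \<longleftrightarrow>
     (\<forall>n. degree (P n) = n \<and> lead_coeff (P n) = 1) \<and>
     (\<forall>i j. (LINT z|lborel. poly (P j) z * poly (P i) z * w z) = (if i = j then h j else 0))"

text \<open>
  \<open>singular_integral A B \<gamma> t f\<close> is \<open>\<gamma> \<integral> f(y) w(y) / (y - t) dy\<close>. The integrand behaves like
  \<open>\<bar>y - t\<bar> powr (\<gamma> - 1)\<close> at \<open>t\<close>, so the integral converges for \<open>\<gamma> > 0\<close> only; for
  \<open>-1 < \<gamma> \<le> 0\<close> it is read as its Hadamard finite part. After cutting out \<open>[t - \<epsilon>, t + \<epsilon>]\<close>
  the divergent terms are \<open>- (A + B) f(t) \<epsilon> powr \<gamma>\<close> from the right of \<open>t\<close> and
  \<open>A f(t) \<epsilon> powr \<gamma>\<close> from the left (the exponential factor of the weight is 1 at \<open>t\<close>), so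
  \<open>B f(t) \<epsilon> powr \<gamma>\<close> compensates them. For \<open>\<gamma> > 0\<close> this term vanishes in the limit and the plain
  integral results, see \<open>R_aux_eq_LINT\<close> and \<open>r_aux_eq_LINT\<close>. For \<open>\<gamma> = 0\<close> the value is \<open>B f(t)\<close>, the limit
  as \<open>\<gamma>\<close> tends to 0.
\<close>

definition singular_integral :: "real \<Rightarrow> real \<Rightarrow> real \<Rightarrow> real \<Rightarrow> (real \<Rightarrow> real) \<Rightarrow> real" where
  "singular_integral A B \<gamma> t f =
     Lim (at_right 0) (\<lambda>\<epsilon>.
       \<gamma> * (LINT y:{y. \<epsilon> < \<bar>y - t\<bar>}|lborel. f y * weight A B \<gamma> t y / (y - t))
       + B * f t * \<epsilon> powr \<gamma>)"

definition R_aux ::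
  "real \<Rightarrow> real \<Rightarrow> real \<Rightarrow> (real \<Rightarrow> nat \<Rightarrow> real poly) \<Rightarrow> (real \<Rightarrow> nat \<Rightarrow> real) \<Rightarrow> nat \<Rightarrow> real \<Rightarrow> real" where
  "R_aux A B \<gamma> P h n t =
     singular_integral A B \<gamma> t (\<lambda>y. (poly (P t n) y)\<^sup>2) / h t n"

text \<open>The value at \<open>n = 0\<close> is the usual convention \<open>P\<^sub>-\<^sub>1 = 0\<close>.\<close>

definition r_aux ::
  "real \<Rightarrow> real \<Rightarrow> real \<Rightarrow> (real \<Rightarrow> nat \<Rightarrow> real poly) \<Rightarrow> (real \<Rightarrow> nat \<Rightarrow> real) \<Rightarrow> nat \<Rightarrow> real \<Rightarrow> real" where
  "r_aux A B \<gamma> P h n t =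
     (if n = 0 then 0
      else singular_integral A B \<gamma> t (\<lambda>y. poly (P t n) y * poly (P t (n - 1)) y) / h t (n - 1))"

lemma poly_exp_bound:
  fixes p :: "real poly"
  shows "\<exists>C k. 0 \<le> C \<and> 0 \<le> k \<and> (\<forall>y. \<bar>poly p y\<bar> \<le> C * exp (k * \<bar>y\<bar>))"
proof (induction p)
  case 0
  show ?case by (intro exI[of _ 0]) auto
next
  case (pCons a p)
  then obtain C k where C: "0 \<le> C" "0 \<le> k" "\<And>y. \<bar>poly p y\<bar> \<le> C * exp (k * \<bar>y\<bar>)" by blast
  have "\<bar>poly (pCons a p) y\<bar> \<le> (\<bar>a\<bar> + C) * exp ((k + 1) * \<bar>y\<bar>)" for y
  proof -
    have e: "\<bar>y\<bar> \<le> exp \<bar>y\<bar>" using exp_ge_add_one_self[of "\<bar>y\<bar>"] by linarith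
    have "\<bar>y\<bar> * \<bar>poly p y\<bar> \<le> exp \<bar>y\<bar> * (C * exp (k * \<bar>y\<bar>))"
      by (intro mult_mono e C) auto
    moreover have "(k + 1) * \<bar>y\<bar> = \<bar>y\<bar> + k * \<bar>y\<bar>" by (simp add: algebra_simps)
    then have "exp \<bar>y\<bar> * (C * exp (k * \<bar>y\<bar>)) = C * exp ((k + 1) * \<bar>y\<bar>)"
      by (simp only: exp_add mult_ac)
    moreover have "1 \<le> exp ((k + 1) * \<bar>y\<bar>)" using C by simp
    then have "\<bar>a\<bar> * 1 \<le> \<bar>a\<bar> * exp ((k + 1) * \<bar>y\<bar>)" by (intro mult_left_mono) auto
    moreover have "\<bar>poly (pCons a p) y\<bar> \<le> \<bar>a\<bar> + \<bar>y\<bar> * \<bar>poly p y\<bar>"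
      by (simp add: abs_mult[symmetric])
    ultimately show ?thesis unfolding distrib_right by linarith
  qed
  then show ?case using C by (intro exI[of _ "\<bar>a\<bar> + C"] exI[of _ "k + 1"]) auto
qed

lemma integrable_powr_exp:
  fixes \<gamma> t :: real
  assumes "\<gamma> > 0"
  shows "integrable lborel (\<lambda>y. \<bar>y - t\<bar> powr (\<gamma> - 1) * exp (- \<bar>y - t\<bar>))"
proof -
  let ?g = "\<lambda>s::real. indicator {0..} s * (\<bar>s\<bar> powr (\<gamma> - 1) * exp (- \<bar>s\<bar>))"
  have "(\<lambda>s. s powr (\<gamma> - 1) / exp s) absolutely_integrable_on {0..}"
    using Gamma_integral_real[OF assms]
    by (intro nonnegative_absolutely_integrable_1) (auto simp: has_integral_integrable)
  then have "integrable lebesgue (\<lambda>s. indicator {0..} s *\<^sub>R (s powr (\<gamma> - 1) / exp s))"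
    by (simp add: set_integrable_def)
  moreover have "(\<lambda>s. indicator {0..} s *\<^sub>R (s powr (\<gamma> - 1) / exp s)) = ?g"
    by (auto simp: indicator_def exp_minus divide_inverse)
  moreover have "?g \<in> borel_measurable lborel" by measurable
  ultimately have g: "integrable lborel ?g" by (simp add: integrable_completion)
  have "integrable lborel (\<lambda>y. ?g (- t + 1 * y))"
    by (rule lborel_integrable_real_affine[OF g]) simp
  moreover have "integrable lborel (\<lambda>y. ?g (t + (- 1) * y))"
    by (rule lborel_integrable_real_affine[OF g]) simp
  ultimately have "integrable lborel (\<lambda>y. ?g (- t + 1 * y) + ?g (t + (- 1) * y))"
    by (rule Bochner_Integration.integrable_add)
  moreover have "(\<lambda>y. ?g (- t + 1 * y) + ?g (t + (- 1) * y))
      = (\<lambda>y. \<bar>y - t\<bar> powr (\<gamma> - 1) * exp (- \<bar>y - t\<bar>))"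
    by (auto simp: indicator_def fun_eq_iff abs_minus_commute)
  ultimately show ?thesis by simp
qed

lemma weight_measurable [measurable]: "weight A B \<gamma> t \<in> borel_measurable borel"
  unfolding weight_def[abs_def] step_def by measurable

lemma poly_measurable [measurable]: "poly (p :: real poly) \<in> borel_measurable borel"
  by (intro borel_measurable_continuous_onI continuous_intros)

lemma integrable_singular:
  fixes p :: "real poly"
  assumes "\<gamma> > 0"
  shows "integrable lborel (\<lambda>y. poly p y * weight A B \<gamma> t y / (y - t))"
proof -
  obtain C k where C: "0 \<le> C" "0 \<le> k" "\<And>y. \<bar>poly p y\<bar> \<le> C * exp (k * \<bar>y\<bar>)"
    using poly_exp_bound by blast
  define m where "m = \<bar>t\<bar> + k + 1"
  define K where "K = C * exp (m\<^sup>2 / 4 + \<bar>t\<bar>) * (\<bar>A\<bar> + \<bar>B\<bar>)"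
  have K: "0 \<le> K" using C by (simp add: K_def)
  have b: "\<bar>poly p y * weight A B \<gamma> t y / (y - t)\<bar>
      \<le> K * (\<bar>y - t\<bar> powr (\<gamma> - 1) * exp (- \<bar>y - t\<bar>))" for y
  proof -
    have 0: "k * \<bar>y\<bar> + (- (y\<^sup>2) + t * y) \<le> m\<^sup>2 / 4 + \<bar>t\<bar> - \<bar>y - t\<bar>"
    proof -
      have "t * y \<le> \<bar>t\<bar> * \<bar>y\<bar>" by (metis abs_ge_self abs_mult)
      moreover have "\<bar>y - t\<bar> \<le> \<bar>y\<bar> + \<bar>t\<bar>" by linarith
      moreover have "0 \<le> (\<bar>y\<bar> - m / 2)\<^sup>2" by simp
      then have "m * \<bar>y\<bar> \<le> y\<^sup>2 + m\<^sup>2 / 4" by (simp add: power2_eq_square field_simps)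
      moreover have "m * \<bar>y\<bar> = \<bar>t\<bar> * \<bar>y\<bar> + k * \<bar>y\<bar> + \<bar>y\<bar>" by (simp add: m_def algebra_simps)
      ultimately show ?thesis by linarith
    qed
    have 1: "\<bar>poly p y\<bar> * exp (- (y\<^sup>2) + t * y) \<le> C * exp (m\<^sup>2 / 4 + \<bar>t\<bar>) * exp (- \<bar>y - t\<bar>)"
    proof -
      have "\<bar>poly p y\<bar> * exp (- (y\<^sup>2) + t * y) \<le> C * exp (k * \<bar>y\<bar>) * exp (- (y\<^sup>2) + t * y)"
        by (intro mult_right_mono C) auto
      also have "\<dots> = C * exp (k * \<bar>y\<bar> + (- (y\<^sup>2) + t * y))" by (simp add: exp_add)
      also have "\<dots> \<le> C * exp (m\<^sup>2 / 4 + \<bar>t\<bar> - \<bar>y - t\<bar>)"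
        using 0 C by (intro mult_left_mono) auto
      also have "\<dots> = C * exp (m\<^sup>2 / 4 + \<bar>t\<bar>) * exp (- \<bar>y - t\<bar>)"
        unfolding diff_conv_add_uminus[of _ "\<bar>y - t\<bar>"] exp_add[of _ "- \<bar>y - t\<bar>"] by simp
      finally show ?thesis .
    qed
    have 2: "\<bar>A + B * step (y - t)\<bar> \<le> \<bar>A\<bar> + \<bar>B\<bar>" by (auto simp: step_def)
    have 3: "\<bar>y - t\<bar> powr \<gamma> / \<bar>y - t\<bar> = \<bar>y - t\<bar> powr (\<gamma> - 1)"
      by (cases "y = t") (auto simp: powr_diff)
    have "\<bar>poly p y * weight A B \<gamma> t y / (y - t)\<bar>
        = (\<bar>poly p y\<bar> * exp (- (y\<^sup>2) + t * y)) * \<bar>A + B * step (y - t)\<bar> * (\<bar>y - t\<bar> powr \<gamma> / \<bar>y - t\<bar>)"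
      by (simp add: weight_def abs_mult)
    also have "\<dots> \<le> (C * exp (m\<^sup>2 / 4 + \<bar>t\<bar>) * exp (- \<bar>y - t\<bar>)) * (\<bar>A\<bar> + \<bar>B\<bar>) * (\<bar>y - t\<bar> powr \<gamma> / \<bar>y - t\<bar>)"
      using C by (intro mult_right_mono mult_mono 1 2) auto
    also have "\<dots> = K * (\<bar>y - t\<bar> powr (\<gamma> - 1) * exp (- \<bar>y - t\<bar>))"
      by (simp add: K_def 3 mult_ac)
    finally show ?thesis .
  qed
  show ?thesis
  proof (rule Bochner_Integration.integrable_bound)
    show "integrable lborel (\<lambda>y. K * (\<bar>y - t\<bar> powr (\<gamma> - 1) * exp (- \<bar>y - t\<bar>)))"
      using integrable_powr_exp[OF assms] by simp
    show "AE y in lborel. norm (poly p y * weight A B \<gamma> t y / (y - t))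
        \<le> norm (K * (\<bar>y - t\<bar> powr (\<gamma> - 1) * exp (- \<bar>y - t\<bar>)))"
      using b K by (intro AE_I2) (simp add: abs_mult)
  qed measurable
qed

lemma singular_integral_eq_LINT:
  fixes p :: "real poly"
  assumes "\<gamma> > 0"
  shows "singular_integral A B \<gamma> t (poly p) =
           \<gamma> * (LINT y|lborel. poly p y * weight A B \<gamma> t y / (y - t))"
proof -
  let ?g = "\<lambda>y. poly p y * weight A B \<gamma> t y / (y - t)"
  let ?I = "\<lambda>\<epsilon>. LINT y:{y. \<epsilon> < \<bar>y - t\<bar>}|lborel. ?g y"
  have int: "integrable lborel ?g" by (rule integrable_singular[OF assms])
  have "(?I \<longlongrightarrow> (LINT y|lborel. ?g y)) (at_right 0)"
  proof (rule tendsto_at_right_sequentially[of 0 1])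
    fix S :: "nat \<Rightarrow> real"
    assume S: "\<And>n. 0 < S n" "S \<longlonglongrightarrow> 0"
    show "(\<lambda>n. ?I (S n)) \<longlonglongrightarrow> (LINT y|lborel. ?g y)"
      unfolding set_lebesgue_integral_def
    proof (rule integral_dominated_convergence[where w = "\<lambda>y. norm (?g y)"])
      show "AE y in lborel. (\<lambda>n. indicator {y. S n < \<bar>y - t\<bar>} y *\<^sub>R ?g y) \<longlonglongrightarrow> ?g y"
      proof (rule AE_I2)
        fix y
        show "(\<lambda>n. indicator {y. S n < \<bar>y - t\<bar>} y *\<^sub>R ?g y) \<longlonglongrightarrow> ?g y"
        proof (cases "y = t")
          case False
          then have "\<forall>\<^sub>F n in sequentially. S n < \<bar>y - t\<bar>"
            using order_tendstoD(2)[OF S(2)] by simp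
          then have "\<forall>\<^sub>F n in sequentially. indicator {y. S n < \<bar>y - t\<bar>} y *\<^sub>R ?g y = ?g y"
            by eventually_elim simp
          then show ?thesis by (rule tendsto_eventually)
        qed simp
      qed
      show "AE y in lborel. norm (indicator {y. S n < \<bar>y - t\<bar>} y *\<^sub>R ?g y) \<le> norm (?g y)" for n
        by (intro AE_I2) (auto simp: indicator_def)
          show "integrable lborel (\<lambda>y. norm (?g y))" using int by (rule integrable_norm)
    qed measurable
  qed simp
  moreover have "((\<lambda>\<epsilon>. \<epsilon> powr \<gamma>) \<longlongrightarrow> 0) (at_right (0::real))"
  proof -
    have "((\<lambda>\<epsilon>. \<epsilon> powr \<gamma>) \<longlongrightarrow> 0 powr \<gamma>) (at_right (0::real))"
      using assms by (intro tendsto_powr2) (auto simp: eventually_at_filter)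
    then show ?thesis by simp
  qed
  ultimately have "((\<lambda>\<epsilon>. \<gamma> * ?I \<epsilon> + B * poly p t * \<epsilon> powr \<gamma>)
      \<longlongrightarrow> \<gamma> * (LINT y|lborel. ?g y) + B * poly p t * 0) (at_right 0)"
    by (intro tendsto_intros)
  then show ?thesis
    unfolding singular_integral_def by (intro tendsto_Lim) auto
qed

lemma R_aux_eq_LINT:
  assumes "\<gamma> > 0"
  shows "R_aux A B \<gamma> P h n t =
           \<gamma> / h t n * (LINT y|lborel. (poly (P t n) y)\<^sup>2 * weight A B \<gamma> t y / (y - t))"
  using singular_integral_eq_LINT[OF assms, of A B t "(P t n)\<^sup>2"]
  by (simp add: R_aux_def poly_power[abs_def])

lemma r_aux_eq_LINT:
  assumes "\<gamma> > 0" and "n \<noteq> 0"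
  shows "r_aux A B \<gamma> P h n t =
           \<gamma> / h t (n - 1) *
             (LINT y|lborel. poly (P t n) y * poly (P t (n - 1)) y * weight A B \<gamma> t y / (y - t))"
  using singular_integral_eq_LINT[OF assms(1), of A B t "P t n * P t (n - 1)"] assms(2)
  by (simp add: r_aux_def poly_mult[abs_def])

end

theory Submission
  imports Defs "HOL-Real_Asymp.Real_Asymp"
begin

text \<open>
  Substituting \<open>z = t + x\<close> moves the singularity of the weight to the fixed point \<open>x = 0\<close>. The weight becomes
  \<open>u(x) = exp (- x\<^sup>2 - t x) \<bar>x\<bar> powr \<gamma> (A + B \<theta>(x))\<close>, whose \<open>t\<close>-derivative is just \<open>- x u\<close>, so for every \<open>\<gamma> > -1\<close> the shifted
  polynomials \<open>Q\<^sub>n\<close> evolve by the Toda equations for their recurrence coefficients \<open>\<alpha>\<^sub>n\<close>, \<open>\<beta>\<^sub>n\<close>.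
  Let \<open>L p = \<integral> p u\<close>. Integrating by parts, the finite part \<open>S p\<close> of \<open>\<gamma> \<integral> p u / x\<close> is \<open>L ((2 x + t) p) - L (p')\<close>, while
  \<open>S (x p) = \<gamma> L p\<close>. The first formula gives \<open>R\<^sub>n = 2 \<alpha>\<^sub>n + t\<close> and \<open>r\<^sub>n = 2 \<beta>\<^sub>n - n\<close>. Comparing both on \<open>x Q\<^sub>n\<^sup>2\<close>
  gives the equation for \<open>R\<^sub>n'\<close>. Splitting off the constant term of one factor in \<open>S (Q\<^sub>n\<^sup>2)\<close>, \<open>S (Q\<^sub>n\<^sub>-\<^sub>1\<^sup>2)\<close> and
  (in two ways) \<open>S (Q\<^sub>n Q\<^sub>n\<^sub>-\<^sub>1)\<close> gives \<open>\<beta>\<^sub>n R\<^sub>n R\<^sub>n\<^sub>-\<^sub>1 = r\<^sub>n (r\<^sub>n - \<gamma>)\<close>, hence the equation for \<open>r\<^sub>n'\<close>.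
\<close>

section \<open>Orthogonal polynomials for a definite functional\<close>

abbreviation X :: "real poly" where "X \<equiv> monom 1 (Suc 0)"

lemma pCons_eq_X: "pCons a p = [:a:] + X * p"
  by (simp add: monom_Suc monom_0)

lemma coeff_X_mult: "coeff (X * p) n = (if n = 0 then 0 else coeff p (n - 1))"
  by (simp add: coeff_monom_mult)

lemma degree_X_mult_le: "degree (X * p) \<le> Suc (degree p)"
  by (rule order.trans[OF degree_mult_le]) (simp add: degree_monom_eq)

text \<open>\<open>L_definite\<close> gives \<open>h n \<noteq> 0\<close> and allows a polynomial
  identity to be proved by testing the difference of its sides against the \<open>Q k\<close>, see
  \<open>eq_0_if_orth\<close>.\<close>

locale orthogonal_functional =
  fixes L :: "real poly \<Rightarrow> real" and Q :: "nat \<Rightarrow> real poly" and h :: "nat \<Rightarrow> real"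
  assumes L_add: "L (p + q) = L p + L q"
    and L_smult: "L (smult c p) = c * L p"
    and L_definite: "L (p * p) = 0 \<Longrightarrow> p = 0"
    and degree_Q [simp]: "degree (Q n) = n"
    and lead_Q: "lead_coeff (Q n) = 1"
    and orth: "L (Q i * Q j) = (if i = j then h i else 0)"
begin

lemma L_0 [simp]: "L 0 = 0"
  using L_smult[of 0 0] by simp

lemma L_diff: "L (p - q) = L p - L q"
  using L_add[of p "smult (- 1) q"] L_smult[of "- 1" q] by simp

lemmas L_linear = L_add L_diff L_smult

lemma coeff_Q [simp]: "coeff (Q n) n = 1"
  using lead_Q[of n] by simp

lemma Q_0: "Q 0 = 1"
  using degree_Q[of 0] coeff_Q[of 0] by (metis degree_eq_zeroE coeff_pCons_0 one_pCons)

lemma h_nonzero [simp]: "h n \<noteq> 0"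
  using L_definite[of "Q n"] orth[of n n] coeff_Q[of n] by fastforce

text \<open>The \<open>Q k\<close> are monic, one in each degree, so subtracting
  \<open>lead_coeff q\<close> times \<open>Q (degree q)\<close> lowers the degree of
  \<open>q\<close>; induct on it.\<close>

lemma L_eq_0_if_orth:
  assumes "\<And>k. k \<le> m \<Longrightarrow> L (D * Q k) = 0" and "degree q \<le> m"
  shows "L (D * q) = 0"
  using assms(2)
proof (induction "degree q" arbitrary: q rule: less_induct)
  case less
  define q' where "q' = q - smult (lead_coeff q) (Q (degree q))"
  have q: "q = smult (lead_coeff q) (Q (degree q)) + q'"
    by (simp add: q'_def)
  have "L (D * q) = lead_coeff q * L (D * Q (degree q)) + L (D * q')"
    by (subst q) (simp only: L_linear distrib_left mult_smult_right)
  also have "L (D * Q (degree q)) = 0"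
    using less.prems by (rule assms(1))
  also have "L (D * q') = 0"
  proof (cases "q' = 0")
    case False
    have "degree q' < degree q"
    \<comment> \<open>At degree 0 no drop is possible; instead \<open>Q 0 = 1\<close> makes
      \<open>q'\<close> vanish, contrary to the case assumption.\<close>
    proof (cases "degree q = 0")
      case True
      then obtain c where "q = [:c:]"
        by (metis degree_eq_zeroE)
      then have "q' = 0"
        by (simp add: q'_def Q_0)
      then show ?thesis
        using False by simp
    next
      case pos: False
      have "degree q' \<le> degree q" and "coeff q' (degree q) = 0"
        by (auto simp: q'_def intro!: degree_diff_le order.trans[OF degree_smult_le])
      then show ?thesis
        using eq_zero_or_degree_less[of q' "degree q"] False by auto
    qed
    then show ?thesis
      using less.hyps[of q'] less.prems by simp
  qed simp
  finally show ?case
    by simp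
qed

lemma L_Q_lower: "degree q < n \<Longrightarrow> L (Q n * q) = 0"
  by (rule L_eq_0_if_orth[where m = "n - 1"]) (auto simp: orth)

lemma eq_0_if_orth:
  assumes "\<And>k. k \<le> m \<Longrightarrow> L (D * Q k) = 0" and "degree D \<le> m"
  shows "D = 0"
  using L_eq_0_if_orth[OF assms] L_definite by blast

text \<open>Removing \<open>coeff q n\<close> times \<open>Q n\<close> leaves a polynomial of degree
  below \<open>n\<close>, which is orthogonal to \<open>Q n\<close>.\<close>

lemma L_Q_degree_le:
  assumes "degree q \<le> n"
  shows "L (Q n * q) = coeff q n * h n"
proof -
  define q' where "q' = q - smult (coeff q n) (Q n)"
  have "degree q' \<le> n" and "coeff q' n = 0"
    using assms by (auto simp: q'_def intro: degree_diff_le order.trans[OF degree_smult_le])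
  then have "q' = 0 \<or> degree q' < n"
    using eq_zero_or_degree_less by blast
  then have "L (Q n * q') = 0"
    using L_Q_lower by auto
  then show ?thesis
    by (simp add: q'_def right_diff_distrib L_linear orth)
qed

section \<open>Three-term recurrence and first moments of the orthogonal polynomials\<close>

definition \<alpha> :: "nat \<Rightarrow> real" where
  "\<alpha> n = L (X * (Q n * Q n)) / h n"

text \<open>The value 0 at \<open>n = 0\<close> removes the term with \<open>Q (n - 1)\<close> from
  the recurrence there; truncated subtraction would otherwise make it \<open>Q 0\<close>.\<close>

definition \<beta> :: "nat \<Rightarrow> real" where
  "\<beta> n = (if n = 0 then 0 else h n / h (n - 1))"

lemma \<beta>_0 [simp]: "\<beta> 0 = 0"
  and \<beta>_Suc: "\<beta> (Suc n) = h (Suc n) / h n"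
  by (simp_all add: \<beta>_def)

text \<open>The leading terms cancel in \<open>D\<close>, so its degree is at most \<open>n\<close>.
  Moving \<open>X\<close> onto \<open>Q k\<close> shows that \<open>X * Q n\<close> pairs to zero
  with \<open>Q k\<close> for \<open>k < n - 1\<close>; the cases \<open>k = n\<close> and
  \<open>k = n - 1\<close> fix the two coefficients.\<close>

lemma recurrence: "X * Q n = Q (Suc n) + smult (\<alpha> n) (Q n) + smult (\<beta> n) (Q (n - 1))"
proof -
  define D where "D = X * Q n - Q (Suc n) - smult (\<alpha> n) (Q n) - smult (\<beta> n) (Q (n - 1))"
  have "degree D \<le> Suc n" "coeff D (Suc n) = 0"
    unfolding D_def
    by (auto intro!: degree_diff_le order.trans[OF degree_smult_le] order.trans[OF degree_X_mult_le]
        simp: coeff_eq_0 coeff_X_mult)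
  then have deg: "degree D \<le> n"
    using eq_zero_or_degree_less[of D "Suc n"] by auto
  have "L (D * Q k) = 0" if "k \<le> n" for k
  proof -
    have "L (X * Q n * Q k) =
        (if k = n then \<alpha> n * h n else if Suc k = n then h n else 0)"
    proof (cases "k = n")
      case True
      then show ?thesis by (simp add: \<alpha>_def mult.assoc)
    next
      case False
      have "L (X * Q n * Q k) = L (Q n * (X * Q k))"
        by (simp add: mult_ac)
      also have "\<dots> = coeff (X * Q k) n * h n"
        using False that
        by (intro L_Q_degree_le order.trans[OF degree_X_mult_le]) simp
      finally show ?thesis
        using False that by (auto simp: coeff_X_mult coeff_eq_0)
    qed
    then show ?thesis
      using that by (cases n) (auto simp: D_def left_diff_distrib L_linear orth \<beta>_Suc)
  qed
  from eq_0_if_orth[OF this deg] show ?thesis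
    by (simp add: D_def algebra_simps)
qed

lemma h_eq: "n \<noteq> 0 \<Longrightarrow> h n = \<beta> n * h (n - 1)"
  by (simp add: \<beta>_def)

lemma L_X_Q_Q: "L (X * (Q n * Q n)) = \<alpha> n * h n"
  by (simp add: \<alpha>_def)

text \<open>The factor \<open>\<beta> n\<close> keeps the formula true at \<open>n = 0\<close>,
  where \<open>n - 1\<close> is again 0 and the moment need not be \<open>h 0\<close>.\<close>

lemma \<beta>_L_X_Q_Q_prev: "\<beta> n * L (X * (Q n * Q (n - 1))) = \<beta> n * h n"
proof (cases n)
  case (Suc m)
  have "X * (Q n * Q (n - 1)) = X * Q n * Q (n - 1)"
    by (simp add: mult.assoc)
  then show ?thesis
    by (simp only: recurrence) (simp add: distrib_right L_linear orth Suc \<beta>_Suc)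
qed simp

text \<open>This is the square norm of \<open>X * Q n\<close>: expand both factors by the recurrence
  and use orthogonality.\<close>

lemma L_X_X_Q_Q: "L (X * (X * (Q n * Q n))) = (\<beta> (Suc n) + (\<alpha> n)\<^sup>2 + \<beta> n) * h n"
proof -
  have 1: "X * (X * (Q n * Q n)) = (X * Q n) * (X * Q n)"
    by (simp only: mult_ac)
  show ?thesis
    unfolding 1 recurrence
    by (simp only: distrib_right distrib_left mult_smult_left mult_smult_right L_linear orth)
      (cases n; simp add: \<beta>_Suc power2_eq_square distrib_right)
qed

end

section \<open>String equation and quadratic relation for a semiclassical functional\<close>

text \<open>Eliminating \<open>S\<close> between the two axioms, with \<open>X * p\<close> put for
  \<open>p\<close> in \<open>S_eq\<close>, gives the weak form of the Pearson equation
  \<open>x u' = (\<gamma> - t x - 2 x^2) u\<close>. Keeping \<open>S\<close> separate also covers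
  polynomials that do not vanish at 0.\<close>

locale semiclassical_functional = orthogonal_functional +
  fixes S :: "real poly \<Rightarrow> real" and t \<gamma> :: real
  assumes S_eq: "S p = L ([:t, 2:] * p) - L (pderiv p)"
    and S_X: "S (X * p) = \<gamma> * L p"
begin

lemma linear_poly_mult: "[:t, 2:] * p = smult 2 (X * p) + smult t p"
  by (subst pCons_eq_X) (simp add: distrib_right)

lemma S_add: "S (p + q) = S p + S q"
  by (simp add: S_eq L_linear distrib_left pderiv_add)

lemma S_smult: "S (smult c p) = c * S p"
  by (simp only: S_eq L_linear pderiv_smult mult_smult_right right_diff_distrib)

lemma degree_pderiv_Q: "degree (pderiv (Q n)) = n - 1"
  by (simp add: degree_pderiv)

lemma L_Q_pderiv_Q: "L (Q n * pderiv (Q n)) = 0"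
  by (cases n) (auto intro: L_Q_lower simp: degree_pderiv_Q Q_0)

lemma S_Q_Q: "S (Q n * Q n) = (2 * \<alpha> n + t) * h n"
  by (simp only: S_eq linear_poly_mult L_linear L_X_Q_Q orth pderiv_mult L_Q_pderiv_Q)
    (simp add: algebra_simps)

text \<open>Of the two terms of the derivative, the one with \<open>pderiv (Q (n - 1))\<close>
  vanishes by degree; the other is \<open>n * h (n - 1)\<close> because \<open>pderiv (Q n)\<close>
  has leading coefficient \<open>n\<close>.\<close>

lemma S_Q_Q_prev:
  assumes "n \<noteq> 0"
  shows "S (Q n * Q (n - 1)) = (2 * \<beta> n - n) * h (n - 1)"
proof -
  obtain m where m: "n = Suc m"
    using assms not0_implies_Suc by blast
  have 1: "L (Q n * pderiv (Q (n - 1))) = 0"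
    by (rule L_Q_lower) (simp add: degree_pderiv_Q m)
  have 2: "L (Q (n - 1) * pderiv (Q n)) = n * h (n - 1)"
    using L_Q_degree_le[of "pderiv (Q n)" "n - 1"] by (simp add: degree_pderiv_Q coeff_pderiv m)
  have 3: "L (X * (Q n * Q (n - 1))) = h n"
    using \<beta>_L_X_Q_Q_prev[of n] h_eq[OF assms] h_nonzero[of n] by auto
  show ?thesis
    by (simp only: S_eq linear_poly_mult L_linear orth pderiv_mult 1 2 3)
      (simp add: h_eq[OF assms] algebra_simps m \<beta>_Suc)
qed

text \<open>Compare the two values of \<open>S (X * (Q n * Q n))\<close>: \<open>S_X\<close> gives
  \<open>\<gamma> * h n\<close>, while \<open>S_eq\<close> gives moments of order one and two and a
  derivative term.\<close>

lemma string_equation: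
  "2 * \<beta> (Suc n) + 2 * \<beta> n + \<alpha> n * (2 * \<alpha> n + t) = 2 * n + 1 + \<gamma>"
proof -
  have 1: "L (X * (Q n * pderiv (Q n))) = n * h n"
  proof -
    have "L (Q n * (X * pderiv (Q n))) = coeff (X * pderiv (Q n)) n * h n"
      by (rule L_Q_degree_le) (cases n; auto simp: degree_pderiv_Q Q_0 intro: order.trans[OF degree_X_mult_le])
    also have "coeff (X * pderiv (Q n)) n = n"
      by (cases n) (auto simp: coeff_X_mult coeff_pderiv)
    finally show ?thesis
      by (simp add: mult_ac)
  qed
  have "pderiv (X * (Q n * Q n)) =
      Q n * Q n + (X * (Q n * pderiv (Q n)) + X * (Q n * pderiv (Q n)))"
    unfolding pderiv_mult pderiv_monom by (simp add: distrib_left mult_ac monom_0)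
  then have "S (X * (Q n * Q n)) =
      2 * ((\<beta> (Suc n) + (\<alpha> n)\<^sup>2 + \<beta> n) * h n) + t * (\<alpha> n * h n) - (h n + 2 * (n * h n))"
    by (simp only: S_eq linear_poly_mult L_linear L_X_X_Q_Q L_X_Q_Q 1 orth) simp
  then have "(2 * \<beta> (Suc n) + 2 * \<beta> n + \<alpha> n * (2 * \<alpha> n + t)) * h n = (2 * n + 1 + \<gamma>) * h n"
    unfolding S_X by (simp add: orth algebra_simps power2_eq_square)
  then show ?thesis
    by simp
qed

text \<open>Write \<open>f\<close> as \<open>f(0) + x q\<close>. The factor \<open>x\<close> cancels
  the singularity, so only the constant term of \<open>f\<close> still involves
  \<open>S\<close>.\<close>

lemma S_mult_split:
  obtains q where "degree q = degree f - 1"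
    and "coeff q (degree f - 1) = (if degree f = 0 then 0 else lead_coeff f)"
    and "\<And>p. S (p * f) = coeff f 0 * S p + \<gamma> * L (p * q)"
proof -
  obtain a q where f: "f = pCons a q"
    by (cases f)
  have "p * f = smult a p + X * (p * q)" for p
    unfolding f by (subst pCons_eq_X) (simp add: distrib_left mult_ac)
  then have "S (p * f) = a * S p + \<gamma> * L (p * q)" for p
    by (simp only: S_add S_smult S_X)
  then show ?thesis
    by (intro that[of q]) (auto simp: f)
qed

text \<open>With \<open>m = n - 1\<close>, facts 1 to 4 below express \<open>S\<close> of products
  of \<open>Q n\<close> and \<open>Q m\<close> by \<open>S (Q n)\<close>, \<open>S (Q m)\<close> and
  the constant terms. The product of the right sides of 1 and 2 is also that of 3 and 4 once
  \<open>\<gamma> * h m\<close> is subtracted in 4.\<close>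

lemma quadratic_relation:
  assumes "n \<noteq> 0"
  shows "\<beta> n * (2 * \<alpha> n + t) * (2 * \<alpha> (n - 1) + t) = (2 * \<beta> n - n) * (2 * \<beta> n - n - \<gamma>)"
proof -
  obtain m where m: "n = Suc m"
    using assms not0_implies_Suc by blast
  obtain q where q: "degree q = m" "coeff q m = 1"
    "\<And>p. S (p * Q n) = coeff (Q n) 0 * S p + \<gamma> * L (p * q)"
    using S_mult_split[of "Q n"] m by auto
  obtain q' where q': "degree q' = m - 1" "m = 0 \<Longrightarrow> coeff q' 0 = 0"
    "\<And>p. S (p * Q m) = coeff (Q m) 0 * S p + \<gamma> * L (p * q')"
    by (rule S_mult_split[of "Q m"]) (auto split: if_splits)
  \<comment> \<open>For \<open>m = 0\<close> the degree of \<open>q'\<close> is not below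
    \<open>m\<close>; there \<open>Q m\<close> is constant and \<open>q'\<close> is zero.\<close>
  have z: "L (Q m * q') = 0"
    using q'(1,2) by (cases m) (auto intro: L_Q_lower elim!: degree_eq_zeroE)
  have 1: "(2 * \<alpha> n + t) * h n = coeff (Q n) 0 * S (Q n)"
    using q(3)[of "Q n"] L_Q_lower[of q n] q(1) m S_Q_Q[of n] by simp
  have 2: "(2 * \<alpha> m + t) * h m = coeff (Q m) 0 * S (Q m)"
    using q'(3)[of "Q m"] z S_Q_Q[of m] by simp
  have 3: "(2 * \<beta> n - n) * h m = coeff (Q m) 0 * S (Q n)"
    using q'(3)[of "Q n"] L_Q_lower[of q' n] q'(1) m S_Q_Q_prev[OF assms] by auto
  \<comment> \<open>Here the correction survives: \<open>q\<close> is monic of degree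
    \<open>m\<close>, so its pairing with \<open>Q m\<close> is \<open>h m\<close>.\<close>
  have 4: "(2 * \<beta> n - n) * h m = coeff (Q n) 0 * S (Q m) + \<gamma> * h m"
    using q(3)[of "Q m"] L_Q_degree_le[of q m] q(1,2) m S_Q_Q_prev[OF assms] by (simp add: mult.commute)
  have "h n = \<beta> n * h m"
    using h_eq[OF assms] m by simp
  then have "(\<beta> n * (2 * \<alpha> n + t) * (2 * \<alpha> m + t)) * (h m * h m)
      = ((2 * \<alpha> n + t) * h n) * ((2 * \<alpha> m + t) * h m)"
    by simp
  also have "\<dots> = ((2 * \<beta> n - n) * h m) * ((2 * \<beta> n - n) * h m - \<gamma> * h m)"
    unfolding 1 2 using 3 4 by simp
  also have "\<dots> = ((2 * \<beta> n - n) * (2 * \<beta> n - n - \<gamma>)) * (h m * h m)"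
    by (simp add: algebra_simps)
  finally show ?thesis
    using m by simp
qed

end

section \<open>Toda evolution of the recurrence coefficients\<close>

text \<open>Differentiation is coefficientwise; together with a degree bound uniform in the
  parameter it reduces everything to finite sums of real functions.\<close>

definition has_poly_derivative :: "(real \<Rightarrow> real poly) \<Rightarrow> real poly \<Rightarrow> real \<Rightarrow> bool" where
  "has_poly_derivative F D t \<longleftrightarrow> (\<forall>k. ((\<lambda>s. coeff (F s) k) has_real_derivative coeff D k) (at t))"

lemma has_poly_derivative_const: "has_poly_derivative (\<lambda>_. p) 0 t"
  by (simp add: has_poly_derivative_def)

lemma has_poly_derivative_diff:
  "has_poly_derivative F D t \<Longrightarrow> has_poly_derivative G E t \<Longrightarrow>
    has_poly_derivative (\<lambda>s. F s - G s) (D - E) t"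
  by (auto simp: has_poly_derivative_def intro!: derivative_intros)

lemma has_poly_derivative_smult:
  "(c has_real_derivative c') (at t) \<Longrightarrow> has_poly_derivative F D t \<Longrightarrow>
    has_poly_derivative (\<lambda>s. smult (c s) (F s)) (smult c' (F t) + smult (c t) D) t"
  by (auto simp: has_poly_derivative_def intro!: derivative_eq_intros)

lemma has_poly_derivative_mult:
  assumes "has_poly_derivative F D t" and "has_poly_derivative G E t"
  shows "has_poly_derivative (\<lambda>s. F s * G s) (D * G t + F t * E) t"
  unfolding has_poly_derivative_def coeff_mult coeff_add sum.distrib[symmetric]
  using assms
  by (auto simp: has_poly_derivative_def intro!: DERIV_sum derivative_eq_intros)

lemma has_poly_derivative_degree_le:
  assumes "has_poly_derivative F D t" and "\<And>s. degree (F s) \<le> d"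
  shows "degree D \<le> d"
proof (rule degree_le, intro allI impI)
  fix k
  assume "d < k"
  then have "coeff (F s) k = 0" for s
    using assms(2)[of s] by (simp add: coeff_eq_0)
  then have "((\<lambda>_. 0) has_real_derivative coeff D k) (at t)"
    using assms(1)[unfolded has_poly_derivative_def, rule_format, of k] by simp
  then show "coeff D k = 0"
    using DERIV_const DERIV_unique by blast
qed

context orthogonal_functional
begin

lemma L_sum: "L (\<Sum>i\<in>I. f i) = (\<Sum>i\<in>I. L (f i))"
  by (induction I rule: infinite_finite_induct) (simp_all add: L_add)

lemma L_mult_eq_sum:
  assumes "degree p \<le> d"
  shows "L (q * p) = (\<Sum>k\<le>d. coeff p k * L (q * monom 1 k))"
proof -
  have "p = (\<Sum>k\<le>d. smult (coeff p k) (monom 1 k))"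
    using poly_as_sum_of_monoms'[OF assms] by (simp add: smult_monom)
  then have "L (q * p) = L (q * (\<Sum>k\<le>d. smult (coeff p k) (monom 1 k)))"
    by simp
  then show ?thesis
    by (simp add: sum_distrib_left L_sum L_smult)
qed

lemma L_eq_sum: "degree p \<le> d \<Longrightarrow> L p = (\<Sum>k\<le>d. coeff p k * L (monom 1 k))"
  using L_mult_eq_sum[of p d 1] by simp

end

locale toda_family =
  fixes L :: "real \<Rightarrow> real poly \<Rightarrow> real" and Q :: "real \<Rightarrow> nat \<Rightarrow> real poly" and h :: "real \<Rightarrow> nat \<Rightarrow> real"
  assumes orthogonal: "orthogonal_functional (L t) (Q t) (h t)"
    and L_deriv: "((\<lambda>s. L s p) has_real_derivative - L t (X * p)) (at t)"
begin

sublocale orthogonal_functional "L t" "Q t" "h t" for t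
  by (rule orthogonal)

text \<open>Product rule for the finite sum of coefficients times moments: the coefficients
  contribute \<open>L t D\<close>, the moments \<open>- L t (X * F t)\<close>.\<close>

lemma L_poly_deriv:
  assumes F: "has_poly_derivative F D t" and deg: "\<And>s. degree (F s) \<le> d"
  shows "((\<lambda>s. L s (F s)) has_real_derivative L t D - L t (X * F t)) (at t)"
proof -
  have "((\<lambda>s. \<Sum>k\<le>d. coeff (F s) k * L s (monom 1 k)) has_real_derivative
      (\<Sum>k\<le>d. coeff D k * L t (monom 1 k) + coeff (F t) k * - L t (X * monom 1 k))) (at t)"
    using F by (auto simp: has_poly_derivative_def intro!: DERIV_sum derivative_eq_intros L_deriv)
  moreover have "(\<lambda>s. \<Sum>k\<le>d. coeff (F s) k * L s (monom 1 k)) = (\<lambda>s. L s (F s))"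
    by (intro ext L_eq_sum[OF deg, symmetric])
  moreover have "(\<Sum>k\<le>d. coeff D k * L t (monom 1 k) + coeff (F t) k * - L t (X * monom 1 k))
      = L t D - L t (X * F t)"
    using deg has_poly_derivative_degree_le[OF F deg] L_mult_eq_sum[of "F t" d t X]
    by (simp add: L_eq_sum[of D d] sum.distrib sum_negf sum_subtractf)
  ultimately show ?thesis
    by simp
qed

text \<open>For \<open>n = 0\<close> the truncated index \<open>n - 1 = 0\<close> is harmless because \<open>\<beta> t 0 = 0\<close>.\<close>

abbreviation (input) Q_deriv :: "real \<Rightarrow> nat \<Rightarrow> bool" where
  "Q_deriv t n \<equiv> has_poly_derivative (\<lambda>s. Q s n) (smult (\<beta> t n) (Q t (n - 1))) t"

lemma \<beta>_orth: "\<beta> t n * L t (Q t n * Q t (n - 1)) = 0"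
  by (cases n) (simp_all add: orth)

text \<open>The motion of \<open>Q s n\<close> contributes nothing, since its derivative is
  orthogonal to \<open>Q t n\<close>; only the derivative of the functional remains.\<close>

lemma h_deriv:
  assumes "Q_deriv t n"
  shows "((\<lambda>s. h s n) has_real_derivative - \<alpha> t n * h t n) (at t)"
proof -
  have "degree (Q s n * Q s n) \<le> 2 * n" for s
    by (rule order.trans[OF degree_mult_le]) simp
  note d = L_poly_deriv[OF has_poly_derivative_mult[OF assms assms] this]
  show ?thesis
    using d unfolding orth
    by (simp only: mult_smult_left mult_smult_right mult.commute[of "Q t (n - 1)" "Q t n"]
        L_linear \<beta>_orth L_X_Q_Q) simp
qed

text \<open>The numerator has derivative
  \<open>(\<beta> t n - \<beta> t (Suc n) - (\<alpha> t n)^2) * h t n\<close>; the square cancels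
  against the derivative of the denominator \<open>h\<close>.\<close>

lemma \<alpha>_deriv:
  assumes "Q_deriv t n"
  shows "((\<lambda>s. \<alpha> s n) has_real_derivative \<beta> t n - \<beta> t (Suc n)) (at t)"
proof -
  have "degree (X * (Q s n * Q s n)) \<le> Suc (2 * n)" for s
    by (rule order.trans[OF degree_X_mult_le]) (simp add: order.trans[OF degree_mult_le])
  note d = L_poly_deriv[OF has_poly_derivative_mult[OF has_poly_derivative_const
        has_poly_derivative_mult[OF assms assms]] this]
  have "L t (0 * (Q t n * Q t n) +
        X * (smult (\<beta> t n) (Q t (n - 1)) * Q t n + Q t n * smult (\<beta> t n) (Q t (n - 1))))
      - L t (X * (X * (Q t n * Q t n))) = (\<beta> t n - \<beta> t (Suc n) - (\<alpha> t n)\<^sup>2) * h t n"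
    by (simp only: mult_zero_left add_0_left distrib_left mult_smult_left mult_smult_right
        mult.commute[of "Q t (n - 1)" "Q t n"] L_linear \<beta>_L_X_Q_Q_prev L_X_X_Q_Q)
      (simp add: algebra_simps)
  note d = d[unfolded this]
  show ?thesis
    unfolding \<alpha>_def
    by (rule DERIV_cong[OF DERIV_divide[OF d h_deriv[OF assms]]])
      (unfold L_X_Q_Q, simp_all add: field_simps power2_eq_square)
qed

lemma \<beta>_deriv:
  assumes "Q_deriv t n" and "Q_deriv t (n - 1)"
  shows "((\<lambda>s. \<beta> s n) has_real_derivative \<beta> t n * (\<alpha> t (n - 1) - \<alpha> t n)) (at t)"
proof (cases n)
  case (Suc m)
  have "((\<lambda>s. h s n / h s m) has_real_derivative \<beta> t n * (\<alpha> t m - \<alpha> t n)) (at t)"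
    by (rule DERIV_cong[OF DERIV_divide[OF h_deriv[OF assms(1)] h_deriv]])
      (use assms(2) Suc in \<open>simp_all add: \<beta>_Suc field_simps\<close>)
  then show ?thesis
    by (simp add: Suc \<beta>_Suc)
qed simp

text \<open>Strong induction along the recurrence: differentiating the formula for
  \<open>Q s (Suc m)\<close> uses \<open>\<alpha>_deriv\<close> and \<open>\<beta>_deriv\<close> at
  \<open>m\<close>, which rest on the claim at \<open>m\<close> and \<open>m - 1\<close>
  only.\<close>

lemma Q_deriv: "Q_deriv t n"
proof (induction n rule: less_induct)
  case (less n)
  show ?case
  proof (cases n)
    case 0
    then show ?thesis
      by (simp add: Q_0 has_poly_derivative_const)
  next
    case (Suc m)
    have Qm: "Q_deriv t m" and Qm': "Q_deriv t (m - 1)"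
      using less[of m] less[of "m - 1"] Suc by auto
    have "Q s n = X * Q s m - smult (\<alpha> s m) (Q s m) - smult (\<beta> s m) (Q s (m - 1))" for s
      by (simp add: recurrence Suc)
    moreover have "has_poly_derivative
        (\<lambda>s. X * Q s m - smult (\<alpha> s m) (Q s m) - smult (\<beta> s m) (Q s (m - 1)))
        (smult (\<beta> t n) (Q t (n - 1))) t"
    proof -
      \<comment> \<open>After expanding \<open>X * Q t (m - 1)\<close> by the recurrence all terms
        cancel except \<open>\<beta> t (Suc m)\<close> times \<open>Q t m\<close>; for
        \<open>m = 0\<close> the factor \<open>\<beta> t 0 = 0\<close> disposes of the rest.\<close>
      have "0 * Q t m + X * smult (\<beta> t m) (Q t (m - 1))
          - (smult (\<beta> t m - \<beta> t (Suc m)) (Q t m) + smult (\<alpha> t m) (smult (\<beta> t m) (Q t (m - 1))))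
          - (smult (\<beta> t m * (\<alpha> t (m - 1) - \<alpha> t m)) (Q t (m - 1))
            + smult (\<beta> t m) (smult (\<beta> t (m - 1)) (Q t (m - 1 - 1))))
          = smult (\<beta> t n) (Q t (n - 1))"
      proof (cases m)
        case (Suc l)
        have "X * smult (\<beta> t m) (Q t l) =
            smult (\<beta> t m) (Q t m + smult (\<alpha> t l) (Q t l) + smult (\<beta> t l) (Q t (l - 1)))"
          by (simp add: recurrence Suc)
        then show ?thesis
          by (intro poly_eqI) (simp add: Suc \<open>n = Suc m\<close> algebra_simps)
      qed (simp add: \<open>n = Suc m\<close>)
      then show ?thesis
        using has_poly_derivative_diff[OF has_poly_derivative_diff[OF
              has_poly_derivative_mult[OF has_poly_derivative_const[of X] Qm]
              has_poly_derivative_smult[OF \<alpha>_deriv[OF Qm] Qm]]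
            has_poly_derivative_smult[OF \<beta>_deriv[OF Qm Qm'] Qm']]
        by simp
    qed
    ultimately show ?thesis
      by simp
  qed
qed

lemmas toda_equations = \<alpha>_deriv[OF Q_deriv] \<beta>_deriv[OF Q_deriv Q_deriv]

end

section \<open>The shifted weight and its singular integrals\<close>

definition shifted_weight :: "real \<Rightarrow> real \<Rightarrow> real \<Rightarrow> real \<Rightarrow> real \<Rightarrow> real" where
  "shifted_weight A B \<gamma> t x = exp (- (x\<^sup>2) - t * x) * \<bar>x\<bar> powr \<gamma> * (A + B * step x)"

lemma weight_eq_shifted_weight: "weight A B \<gamma> t (t + x) = shifted_weight A B \<gamma> t x"
proof -
  have "- ((t + x)\<^sup>2) + t * (t + x) = - (x\<^sup>2) - t * x"
    by (simp add: power2_eq_square algebra_simps)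
  then show ?thesis
    by (simp add: weight_def shifted_weight_def)
qed

lemma shifted_weight_measurable [measurable]: "shifted_weight A B \<gamma> t \<in> borel_measurable borel"
  unfolding shifted_weight_def[abs_def] step_def by measurable

lemma shifted_weight_add: "shifted_weight A B \<gamma> (t + s) x = exp (- (s * x)) * shifted_weight A B \<gamma> t x"
proof -
  have "- (x\<^sup>2) - (t + s) * x = - (s * x) + (- (x\<^sup>2) - t * x)"
    by (simp add: algebra_simps)
  then show ?thesis
    unfolding shifted_weight_def by (simp only: exp_add mult.assoc)
qed

text \<open>Raising the exponent to \<open>\<gamma> + 1 > 0\<close> and dividing by
  \<open>y - t\<close> changes the weight only by the sign of \<open>y - t\<close>. The constants
  \<open>- A\<close> and \<open>2 * A + B\<close> undo this sign: they give \<open>- A\<close> on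
  the left and \<open>A + B\<close> on the right.\<close>

lemma integrable_poly_shifted_weight:
  assumes "\<gamma> > -1"
  shows "integrable lborel (\<lambda>x. poly p x * shifted_weight A B \<gamma> t x)"
proof -
  have eq: "weight A B \<gamma> t y = weight (- A) (2 * A + B) (\<gamma> + 1) t y / (y - t)" for y
    by (auto simp: weight_def step_def powr_add abs_if field_simps)
  have "integrable lborel
      (\<lambda>y. poly (pcompose p [:- t, 1:]) y * weight (- A) (2 * A + B) (\<gamma> + 1) t y / (y - t))"
    by (rule integrable_singular) (use assms in simp)
  then have "integrable lborel (\<lambda>y. poly (pcompose p [:- t, 1:]) y * weight A B \<gamma> t y)"
    by (simp add: eq)
  from lborel_integrable_real_affine[OF this, of 1 t]
  show ?thesis
    by (simp add: poly_pcompose weight_eq_shifted_weight)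
qed

section \<open>Moments of the shifted weight: definiteness and dependence on the parameter\<close>

definition moment :: "real \<Rightarrow> real \<Rightarrow> real \<Rightarrow> real \<Rightarrow> real poly \<Rightarrow> real" where
  "moment A B \<gamma> t p = (LINT x|lborel. poly p x * shifted_weight A B \<gamma> t x)"

lemma moment_add: "\<gamma> > -1 \<Longrightarrow> moment A B \<gamma> t (p + q) = moment A B \<gamma> t p + moment A B \<gamma> t q"
  by (simp add: moment_def distrib_right integrable_poly_shifted_weight)

lemma moment_smult: "moment A B \<gamma> t (smult c p) = c * moment A B \<gamma> t p"
  by (simp add: moment_def mult.assoc)

text \<open>The weight is positive on an open half-line \<open>H\<close> and \<open>p\<close> has
  finitely many roots, so a vanishing integral would make \<open>H\<close> a null set.\<close>

lemma moment_definite: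
  assumes "\<gamma> > -1" and "A \<ge> 0" and "A + B \<ge> 0" and "\<not> (A = 0 \<and> B = 0)"
    and "moment A B \<gamma> t (p * p) = 0"
  shows "p = 0"
proof (rule ccontr)
  assume "p \<noteq> 0"
  \<comment> \<open>If \<open>A = 0\<close> then \<open>B > 0\<close>, and the weight is positive to
    the right of 0.\<close>
  define H where "H = (if A > 0 then {..<0} else {0<..} :: real set)"
  have U_nonneg: "shifted_weight A B \<gamma> t x \<ge> 0" for x
    using assms by (simp add: shifted_weight_def step_def)
  have U_pos: "shifted_weight A B \<gamma> t x > 0" if "x \<in> H" for x
    using assms that by (auto simp: shifted_weight_def step_def H_def split: if_splits)
  have "AE x in lborel. poly (p * p) x * shifted_weight A B \<gamma> t x = 0"
    using assms integrable_poly_shifted_weight[OF assms(1), of "p * p"] U_nonneg unfolding moment_def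
    by (subst (asm) integral_nonneg_eq_0_iff_AE) auto
  moreover have "AE x in lborel. x \<notin> {x. poly p x = 0}"
    using poly_roots_finite[OF \<open>p \<noteq> 0\<close>]
    by (intro AE_not_in finite_imp_null_set_lborel)
  ultimately have "AE x in lborel. x \<notin> H"
    using U_pos by (elim AE_mp, intro AE_I2) fastforce
  then have "H \<in> null_sets lborel"
    by (subst AE_iff_null_sets) (auto simp: H_def)
  then have "emeasure lborel H = 0"
    by auto
  moreover have "emeasure lborel H \<ge> emeasure lborel (if A > 0 then {-1<..<0} else {0<..<1::real})"
    by (rule emeasure_mono) (auto simp: H_def)
  ultimately show False
    by (auto split: if_splits)
qed

text \<open>From \<open>(1 - y) * exp y \<le> 1\<close> the remainder lies between 0 and
  \<open>y * (exp y - 1)\<close>. This is bounded by the same inequality for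
  \<open>y \<ge> 0\<close> and by \<open>exp y - 1 \<ge> y\<close> for \<open>y < 0\<close>.\<close>

lemma abs_exp_minus_linear_le: "\<bar>exp y - 1 - y\<bar> \<le> y\<^sup>2 * exp \<bar>y :: real\<bar>"
proof -
  have 0: "exp y - 1 - y \<ge> 0"
    using exp_ge_add_one_self[of y] by linarith
  have "(1 - y) * exp y \<le> exp (- y) * exp y"
    using exp_ge_add_one_self[of "- y"] by (intro mult_right_mono) auto
  also have "\<dots> = 1"
    by (simp add: exp_add[symmetric])
  finally have 1: "exp y - 1 \<le> y * exp y"
    by (simp add: algebra_simps)
  have 2: "y * (exp y - 1) \<le> y\<^sup>2 * exp \<bar>y\<bar>"
  proof (cases "y \<ge> 0")
    case True
    then show ?thesis
      using mult_left_mono[OF 1 True] by (simp add: power2_eq_square)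
  next
    case False
    then have "y * (exp y - 1) \<le> y * y"
      using exp_ge_add_one_self[of y] by (intro mult_left_mono_neg) linarith+
    also have "\<dots> \<le> y * y * exp \<bar>y\<bar>"
      by (intro mult_right_mono[of 1, simplified] mult_le_cancel_left1[THEN iffD2]) auto
    finally show ?thesis
      by (simp add: power2_eq_square)
  qed
  have "exp y - 1 - y \<le> y * (exp y - 1)"
    using 1 by (simp add: algebra_simps)
  with 0 2 show ?thesis
    by linarith
qed

text \<open>
  The factor \<open>exp \<bar>x\<bar> \<le> exp x + exp (- x)\<close> in the remainder of the linearisation in \<open>t\<close> is absorbed by
  the weights at \<open>t - 1\<close> and \<open>t + 1\<close>.
\<close>

lemma moment_has_derivative:
  assumes "\<gamma> > -1"
  shows "((\<lambda>s. moment A B \<gamma> s p) has_real_derivative - moment A B \<gamma> t (X * p)) (at t)"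
proof -
  define G where "G x = \<bar>poly (monom 1 2 * p) x * shifted_weight A B \<gamma> (t - 1) x\<bar> +
    \<bar>poly (monom 1 2 * p) x * shifted_weight A B \<gamma> (t + 1) x\<bar>" for x
  define C where "C = (LINT x|lborel. G x)"
  have G: "integrable lborel G"
    unfolding G_def
    by (intro Bochner_Integration.integrable_add integrable_abs integrable_poly_shifted_weight assms)
  have bound: "\<bar>moment A B \<gamma> (t + s) p - moment A B \<gamma> t p + s * moment A B \<gamma> t (X * p)\<bar> \<le> s\<^sup>2 * C"
    if s: "\<bar>s\<bar> \<le> 1" for s
  proof -
    let ?D = "\<lambda>x. poly p x * shifted_weight A B \<gamma> (t + s) x - poly p x * shifted_weight A B \<gamma> t x
        + s * (poly (X * p) x * shifted_weight A B \<gamma> t x)"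
    have int: "integrable lborel ?D"
      by (intro Bochner_Integration.integrable_add Bochner_Integration.integrable_diff
          integrable_mult_right integrable_poly_shifted_weight assms)
    have "\<bar>?D x\<bar> \<le> s\<^sup>2 * G x" for x
    proof -
      have "?D x = poly p x * shifted_weight A B \<gamma> t x * (exp (- (s * x)) - 1 - (- (s * x)))"
        unfolding shifted_weight_add[of A B \<gamma> t s] by (simp add: poly_monom algebra_simps)
      then have "\<bar>?D x\<bar> = \<bar>poly p x * shifted_weight A B \<gamma> t x\<bar> * \<bar>exp (- (s * x)) - 1 - (- (s * x))\<bar>"
        by (simp add: abs_mult)
      also have "\<dots> \<le> \<bar>poly p x * shifted_weight A B \<gamma> t x\<bar> * ((- (s * x))\<^sup>2 * exp \<bar>- (s * x)\<bar>)"
        by (intro mult_left_mono abs_exp_minus_linear_le) auto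
      also have "exp \<bar>- (s * x)\<bar> \<le> exp (x * 1) + exp (- x)"
      proof -
        have "\<bar>- (s * x)\<bar> \<le> \<bar>x\<bar>"
          using s by (simp add: abs_mult mult_left_le_one_le)
        then have "exp \<bar>- (s * x)\<bar> \<le> exp \<bar>x\<bar>"
          by simp
        also have "\<dots> \<le> exp (x * 1) + exp (- x)"
          by (cases "x \<ge> 0") auto
        finally show ?thesis .
      qed
      also have "\<bar>poly p x * shifted_weight A B \<gamma> t x\<bar> * ((- (s * x))\<^sup>2 * (exp (x * 1) + exp (- x))) = s\<^sup>2 * G x"
        using shifted_weight_add[of A B \<gamma> t "- 1" x] shifted_weight_add[of A B \<gamma> t 1 x]
        by (simp add: G_def abs_mult poly_monom power_mult_distrib algebra_simps)
      finally show ?thesis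
        by (simp add: mult_left_mono)
    qed
    then have "norm (LINT x|lborel. ?D x) \<le> (LINT x|lborel. s\<^sup>2 * G x)"
      by (intro Bochner_Integration.integral_norm_bound_integral int) (auto simp: G)
    also have "(LINT x|lborel. ?D x) = moment A B \<gamma> (t + s) p - moment A B \<gamma> t p + s * moment A B \<gamma> t (X * p)"
      unfolding moment_def using assms
      by (simp add: integrable_poly_shifted_weight del: poly_mult)
    finally show ?thesis
      by (simp add: C_def)
  qed
  have "((\<lambda>s. (moment A B \<gamma> (t + s) p - moment A B \<gamma> t p) / s - (- moment A B \<gamma> t (X * p))) \<longlongrightarrow> 0) (at 0)"
  proof (rule Lim_null_comparison)
    have "\<forall>\<^sub>F s in at 0. \<bar>s\<bar> < (1::real) \<and> s \<noteq> 0"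
      by (auto simp: eventually_at intro!: exI[of _ 1])
    then show "\<forall>\<^sub>F s in at 0. norm ((moment A B \<gamma> (t + s) p - moment A B \<gamma> t p) / s
        - (- moment A B \<gamma> t (X * p))) \<le> \<bar>s\<bar> * C"
    proof eventually_elim
      case (elim s)
      have "(moment A B \<gamma> (t + s) p - moment A B \<gamma> t p) / s - (- moment A B \<gamma> t (X * p))
          = (moment A B \<gamma> (t + s) p - moment A B \<gamma> t p + s * moment A B \<gamma> t (X * p)) / s"
        using elim by (simp add: field_simps)
      then have "norm ((moment A B \<gamma> (t + s) p - moment A B \<gamma> t p) / s - (- moment A B \<gamma> t (X * p)))
          \<le> s\<^sup>2 * C / \<bar>s\<bar>"
        using bound[of s] elim by (simp add: abs_divide divide_right_mono)
      also have "\<dots> = \<bar>s\<bar> * C"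
        using elim by (simp add: power2_eq_square abs_if)
      finally show ?case .
    qed
    show "((\<lambda>s. \<bar>s\<bar> * C) \<longlongrightarrow> 0) (at 0)"
      by (auto intro!: tendsto_eq_intros)
  qed
  then show ?thesis
    unfolding DERIV_def LIM_zero_iff .
qed

section \<open>Integration by parts and the finite part at the origin\<close>

lemma tendsto_integral_outside:
  fixes f :: "real \<Rightarrow> real"
  assumes f: "integrable lborel f"
  shows "((\<lambda>\<epsilon>. LINT x:{x. \<epsilon> < \<bar>x\<bar>}|lborel. f x) \<longlongrightarrow> (LINT x|lborel. f x)) (at_right 0)"
proof (rule tendsto_at_right_sequentially[of 0 1])
  fix S :: "nat \<Rightarrow> real"
  assume S: "\<And>n. 0 < S n" "S \<longlonglongrightarrow> 0"
  have f_meas [measurable]: "f \<in> borel_measurable borel"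
    using f by simp
  show "(\<lambda>n. LINT x:{x. S n < \<bar>x\<bar>}|lborel. f x) \<longlonglongrightarrow> (LINT x|lborel. f x)"
    unfolding set_lebesgue_integral_def
  proof (rule integral_dominated_convergence[where w = "\<lambda>x. norm (f x)"])
    have lim: "(\<lambda>n. indicator {x. S n < \<bar>x\<bar>} x *\<^sub>R f x) \<longlonglongrightarrow> f x" if "x \<noteq> 0" for x
    proof -
      have "\<forall>\<^sub>F n in sequentially. S n < \<bar>x\<bar>"
        using order_tendstoD(2)[OF S(2)] that by simp
      then have "\<forall>\<^sub>F n in sequentially. indicator {x. S n < \<bar>x\<bar>} x *\<^sub>R f x = f x"
        by eventually_elim simp
      then show ?thesis
        by (rule tendsto_eventually)
    qed
    show "AE x in lborel. (\<lambda>n. indicator {x. S n < \<bar>x\<bar>} x *\<^sub>R f x) \<longlonglongrightarrow> f x"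
      using AE_lborel_singleton[of "0 :: real"] by eventually_elim (rule lim)
    show "AE x in lborel. norm (indicator {x. S n < \<bar>x\<bar>} x *\<^sub>R f x) \<le> norm (f x)" for n
      by (intro AE_I2) (auto simp: indicator_def)
    show "integrable lborel (\<lambda>x. norm (f x))"
      using f by (rule integrable_norm)
  qed measurable
qed simp

lemma poly_times_gaussian_tendsto_0:
  "((\<lambda>x. poly p x * (exp (- (x\<^sup>2) - t * x) * x powr \<gamma>)) \<longlongrightarrow> 0) at_top" for \<gamma> t :: real
proof -
  obtain C k where C: "\<And>y. \<bar>poly p y\<bar> \<le> C * exp (k * \<bar>y\<bar>)"
    using poly_exp_bound by blast
  show ?thesis
  proof (rule Lim_null_comparison)
    show "\<forall>\<^sub>F x in at_top. norm (poly p x * (exp (- (x\<^sup>2) - t * x) * x powr \<gamma>))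
        \<le> C * (exp (k * x) * (exp (- (x\<^sup>2) - t * x) * x powr \<gamma>))"
      using eventually_ge_at_top[of 0]
    proof eventually_elim
      case (elim x)
      then have "\<bar>poly p x\<bar> * (exp (- (x\<^sup>2) - t * x) * x powr \<gamma>)
          \<le> C * exp (k * x) * (exp (- (x\<^sup>2) - t * x) * x powr \<gamma>)"
        using C[of x] by (intro mult_right_mono) auto
      then show ?case
        by (simp add: abs_mult)
    qed
    have "filterlim (\<lambda>x::real. - (x\<^sup>2) + c * x + \<gamma> * ln x) at_bot at_top" for c
      by real_asymp
    from filterlim_compose[OF exp_at_bot this[of "k - t"]]
    have "((\<lambda>x::real. exp (k * x) * (exp (- (x\<^sup>2) - t * x) * x powr \<gamma>)) \<longlongrightarrow> 0) at_top"
    proof (rule Lim_transform_eventually)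
      show "\<forall>\<^sub>F x in at_top. exp (- (x\<^sup>2) + (k - t) * x + \<gamma> * ln x)
          = exp (k * x) * (exp (- (x\<^sup>2) - t * x) * x powr \<gamma>)"
        using eventually_gt_at_top[of 0]
        by eventually_elim (simp add: powr_def exp_add[symmetric] algebra_simps)
    qed
    then show "((\<lambda>x. C * (exp (k * x) * (exp (- (x\<^sup>2) - t * x) * x powr \<gamma>))) \<longlongrightarrow> 0) at_top"
      by (rule tendsto_mult_right_zero)
  qed
qed

text \<open>Here \<open>g * V\<close> is the derivative of \<open>poly p * V\<close>, because
  \<open>V' = (\<gamma> / x - 2 x - t) V\<close>; the boundary term at infinity vanishes.\<close>

lemma integral_derivative_halfline:
  fixes \<gamma> t \<epsilon> :: real and p :: "real poly"
  defines "V \<equiv> \<lambda>x. exp (- (x\<^sup>2) - t * x) * x powr \<gamma>"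
    and "g \<equiv> \<lambda>x. poly (pderiv p) x - (2 * x + t) * poly p x + \<gamma> * poly p x / x"
  assumes "\<gamma> > -1" and "\<epsilon> > 0"
  shows "set_integrable lborel {\<epsilon><..} (\<lambda>x. g x * V x)"
    and "(LINT x:{\<epsilon><..}|lborel. g x * V x) = - (poly p \<epsilon> * V \<epsilon>)"
proof -
  have int: "set_integrable lborel {\<epsilon><..} (\<lambda>x. poly q x * V x)" for q
  proof -
    \<comment> \<open>With \<open>A = 0\<close> and \<open>B = 1\<close> the shifted weight is
      \<open>V\<close> on the positive half-line.\<close>
    have "set_integrable lborel {\<epsilon><..} (\<lambda>x. poly q x * shifted_weight 0 1 \<gamma> t x)"
      using integrable_poly_shifted_weight[OF \<open>\<gamma> > -1\<close>] unfolding set_integrable_def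
      by (intro integrable_mult_indicator) auto
    then show ?thesis
      by (subst (asm) set_integrable_cong[where f' = "\<lambda>x. poly q x * V x"])
        (use \<open>\<epsilon> > 0\<close> in \<open>auto simp: shifted_weight_def V_def step_def\<close>)
  qed
  have V_meas [measurable]: "V \<in> borel_measurable borel"
    unfolding V_def by measurable
  have "set_integrable lborel {\<epsilon><..} (\<lambda>x. poly p x * V x / x)"
  proof (rule set_integrable_bound)
    show "set_integrable lborel {\<epsilon><..} (\<lambda>x. 1 / \<epsilon> * (poly p x * V x))"
      using int by (intro set_integrable_mult_right)
    show "AE x in lborel. x \<in> {\<epsilon><..} \<longrightarrow>
        norm (poly p x * V x / x) \<le> norm (1 / \<epsilon> * (poly p x * V x))"
    proof (intro AE_I2 impI)
      fix x
      assume "x \<in> {\<epsilon><..}"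
      then show "norm (poly p x * V x / x) \<le> norm (1 / \<epsilon> * (poly p x * V x))"
        using \<open>\<epsilon> > 0\<close> by (simp add: abs_mult frac_le)
    qed
  qed (simp add: set_borel_measurable_def)
  then have "set_integrable lborel {\<epsilon><..} (\<lambda>x. poly (pderiv p - [:t, 2:] * p) x * V x
      + \<gamma> * (poly p x * V x / x))"
    by (intro set_integral_add int set_integrable_mult_right)
  moreover have "poly (pderiv p - [:t, 2:] * p) x * V x + \<gamma> * (poly p x * V x / x) = g x * V x" for x
    by (simp add: g_def algebra_simps)
  ultimately show g: "set_integrable lborel {\<epsilon><..} (\<lambda>x. g x * V x)"
    by simp
  have "(LBINT x=ereal \<epsilon>..\<infinity>. g x * V x) = 0 - poly p \<epsilon> * V \<epsilon>"
  proof (rule interval_integral_FTC_integrable)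
    fix x
    assume "ereal \<epsilon> < ereal x"
    then have x: "x > 0"
      using \<open>\<epsilon> > 0\<close> by simp
    show "((\<lambda>x. poly p x * V x) has_vector_derivative g x * V x) (at x)"
      unfolding V_def g_def has_real_derivative_iff_has_vector_derivative[symmetric]
      by (rule derivative_eq_intros refl x | use x in \<open>simp add: field_simps powr_diff\<close>)+
    show "isCont (\<lambda>x. g x * V x) x"
      unfolding V_def g_def using x by (intro continuous_intros) auto
  next
    show "set_integrable lborel (einterval (ereal \<epsilon>) \<infinity>) (\<lambda>x. g x * V x)"
      using g by simp
    have "isCont (\<lambda>x. poly p x * V x) \<epsilon>"
      unfolding V_def using \<open>\<epsilon> > 0\<close> by (intro continuous_intros) auto
    then show "(((\<lambda>x. poly p x * V x) \<circ> real_of_ereal) \<longlongrightarrow> poly p \<epsilon> * V \<epsilon>) (at_right (ereal \<epsilon>))"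
      unfolding ereal_tendsto_simps by (simp add: isCont_def filterlim_at_split)
    show "(((\<lambda>x. poly p x * V x) \<circ> real_of_ereal) \<longlongrightarrow> 0) (at_left \<infinity>)"
      unfolding ereal_tendsto_simps V_def by (rule poly_times_gaussian_tendsto_0)
  qed simp
  then show "(LINT x:{\<epsilon><..}|lborel. g x * V x) = - (poly p \<epsilon> * V \<epsilon>)"
    by (simp add: interval_integral_to_infinity_eq)
qed

text \<open>The left half-line is reflected to the right one, which replaces \<open>p(x)\<close> by
  \<open>q(x) = p(- x)\<close> and \<open>t\<close> by \<open>- t\<close> and reverses the sign:
  \<open>g (- x) = - gq x\<close>.\<close>

lemma integral_derivative_outside:
  fixes \<gamma> t \<epsilon> :: real and p :: "real poly"
  defines "g \<equiv> \<lambda>x. poly (pderiv p) x - (2 * x + t) * poly p x + \<gamma> * poly p x / x"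
  assumes "\<gamma> > -1" and "\<epsilon> > 0"
  shows "set_integrable lborel {x. \<epsilon> < \<bar>x\<bar>} (\<lambda>x. g x * shifted_weight A B \<gamma> t x)"
    and "(LINT x:{x. \<epsilon> < \<bar>x\<bar>}|lborel. g x * shifted_weight A B \<gamma> t x) =
      (A * poly p (- \<epsilon>) * exp (t * \<epsilon>) - (A + B) * poly p \<epsilon> * exp (- (t * \<epsilon>))) *
      (exp (- (\<epsilon>\<^sup>2)) * \<epsilon> powr \<gamma>)"
proof -
  define q where "q = pcompose p [:0, - 1:]"
  define gq where "gq x = poly (pderiv q) x - (2 * x + (- t)) * poly q x + \<gamma> * poly q x / x" for x
  define V where "V s x = exp (- (x\<^sup>2) - s * x) * x powr \<gamma>" for s x
  have g_eq: "poly (pderiv p) x - (2 * x + t) * poly p x + \<gamma> * poly p x / x = g x" for x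
    by (simp add: g_def)
  note right = integral_derivative_halfline[OF assms(2,3), of p t, folded V_def, unfolded g_eq]
  note left = integral_derivative_halfline[OF assms(2,3), of q "- t", folded gq_def V_def]
  have g_right: "g x * shifted_weight A B \<gamma> t x = (A + B) * (g x * V t x)" if "x > 0" for x
    using that by (simp add: shifted_weight_def V_def step_def)
  have g_left: "g (- x) * shifted_weight A B \<gamma> t (- x) = - A * (gq x * V (- t) x)" if "x > 0" for x
    using that by (simp add: shifted_weight_def V_def step_def g_def gq_def q_def poly_pcompose pderiv_pcompose
        pderiv_pCons algebra_simps)
  have int_right: "set_integrable lborel {\<epsilon><..} (\<lambda>x. g x * shifted_weight A B \<gamma> t x)"
    by (subst set_integrable_cong[OF refl refl g_right])
      (use \<open>\<epsilon> > 0\<close> in \<open>force | intro set_integrable_mult_right right(1)\<close>)+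
  have "set_integrable lborel {\<epsilon><..} (\<lambda>x. g (- x) * shifted_weight A B \<gamma> t (- x))"
    by (subst set_integrable_cong[OF refl refl g_left])
      (use \<open>\<epsilon> > 0\<close> in \<open>force | intro set_integrable_mult_right left(1)\<close>)+
  from lborel_integrable_real_affine[OF this[unfolded set_integrable_def], of "- 1" 0]
  have int_left: "set_integrable lborel {..<- \<epsilon>} (\<lambda>x. g x * shifted_weight A B \<gamma> t x)"
    unfolding set_integrable_def
    by (rule Bochner_Integration.integrable_cong[THEN iffD1, rotated 2])
      (auto simp: indicator_def)
  have Un: "{x. \<epsilon> < \<bar>x\<bar>} = {\<epsilon><..} \<union> {..<- \<epsilon>}"
    by auto
  have reflect: "{x. - x \<in> {..<- \<epsilon>}} = {\<epsilon><..}"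
    by auto
  show "set_integrable lborel {x. \<epsilon> < \<bar>x\<bar>} (\<lambda>x. g x * shifted_weight A B \<gamma> t x)"
    unfolding Un by (rule set_integrable_Un[OF int_right int_left]) auto
  have "(LINT x:{x. \<epsilon> < \<bar>x\<bar>}|lborel. g x * shifted_weight A B \<gamma> t x) =
      (LINT x:{\<epsilon><..}|lborel. g x * shifted_weight A B \<gamma> t x) + (LINT x:{..<- \<epsilon>}|lborel. g x * shifted_weight A B \<gamma> t x)"
    unfolding Un using \<open>\<epsilon> > 0\<close> by (intro set_integral_Un int_right int_left) auto
  also have "(LINT x:{\<epsilon><..}|lborel. g x * shifted_weight A B \<gamma> t x) = (A + B) * - (poly p \<epsilon> * V t \<epsilon>)"
    unfolding right(2)[symmetric] set_integral_mult_right[symmetric]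
    by (rule set_lebesgue_integral_cong) (use \<open>\<epsilon> > 0\<close> g_right in auto)
  also have "(LINT x:{..<- \<epsilon>}|lborel. g x * shifted_weight A B \<gamma> t x) = - A * - (poly q \<epsilon> * V (- t) \<epsilon>)"
    unfolding left(2)[symmetric] set_integral_mult_right[symmetric]
    unfolding set_integral_reflect[of "{..<- \<epsilon>}"] reflect
    by (rule set_lebesgue_integral_cong) (use \<open>\<epsilon> > 0\<close> g_left in auto)
  finally show "(LINT x:{x. \<epsilon> < \<bar>x\<bar>}|lborel. g x * shifted_weight A B \<gamma> t x) =
      (A * poly p (- \<epsilon>) * exp (t * \<epsilon>) - (A + B) * poly p \<epsilon> * exp (- (t * \<epsilon>))) *
      (exp (- (\<epsilon>\<^sup>2)) * \<epsilon> powr \<gamma>)"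
    by (simp add: V_def q_def poly_pcompose exp_diff exp_add exp_minus field_simps)
qed

definition regularised :: "real \<Rightarrow> real \<Rightarrow> real \<Rightarrow> real \<Rightarrow> real poly \<Rightarrow> real \<Rightarrow> real" where
  "regularised A B \<gamma> t p \<epsilon> =
    \<gamma> * (LINT x:{x. \<epsilon> < \<bar>x\<bar>}|lborel. poly p x * shifted_weight A B \<gamma> t x / x) + B * poly p 0 * \<epsilon> powr \<gamma>"

lemma set_integrable_poly_shifted_weight:
  assumes "\<gamma> > -1" and "S \<in> sets lborel"
  shows "set_integrable lborel S (\<lambda>x. poly p x * shifted_weight A B \<gamma> t x)"
  unfolding set_integrable_def using assms
  by (intro integrable_mult_indicator integrable_poly_shifted_weight) auto

text \<open>Off the origin \<open>\<gamma> p u / x\<close> is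
  \<open>((2 x + t) p - p') u + (p u)'\<close>. The first summand is integrable; the second leaves
  the boundary terms that the power of \<open>\<epsilon>\<close> compensates.\<close>

lemma regularised_tendsto:
  assumes "\<gamma> > -1"
  shows "(regularised A B \<gamma> t p \<longlongrightarrow> moment A B \<gamma> t ([:t, 2:] * p) - moment A B \<gamma> t (pderiv p)) (at_right 0)"
proof -
  let ?q = "[:t, 2:] * p - pderiv p"
  \<comment> \<open>\<open>\<phi> \<epsilon> * \<epsilon> powr \<gamma>\<close> collects the boundary terms and their compensation; \<open>\<phi>\<close> vanishes to first
    order at 0, which suffices since \<open>\<gamma> + 1 > 0\<close>.\<close>
  define \<phi> where "\<phi> \<epsilon> = (A * poly p (- \<epsilon>) * exp (t * \<epsilon>) - (A + B) * poly p \<epsilon> * exp (- (t * \<epsilon>))) *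
    exp (- (\<epsilon>\<^sup>2)) + B * poly p 0" for \<epsilon>
  have reg: "regularised A B \<gamma> t p \<epsilon> =
      (LINT x:{x. \<epsilon> < \<bar>x\<bar>}|lborel. poly ?q x * shifted_weight A B \<gamma> t x) + \<phi> \<epsilon> / \<epsilon> * \<epsilon> powr (\<gamma> + 1)"
    if \<epsilon>: "\<epsilon> > 0" for \<epsilon>
  proof -
    note d = integral_derivative_outside[OF assms \<epsilon>, of p t A B]
    have "\<gamma> * (LINT x:{x. \<epsilon> < \<bar>x\<bar>}|lborel. poly p x * shifted_weight A B \<gamma> t x / x) =
        (LINT x:{x. \<epsilon> < \<bar>x\<bar>}|lborel. poly ?q x * shifted_weight A B \<gamma> t x +
          (poly (pderiv p) x - (2 * x + t) * poly p x + \<gamma> * poly p x / x) * shifted_weight A B \<gamma> t x)"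
      unfolding set_integral_mult_right[symmetric]
      by (rule set_lebesgue_integral_cong) (auto simp: algebra_simps)
    also have "\<dots> = (LINT x:{x. \<epsilon> < \<bar>x\<bar>}|lborel. poly ?q x * shifted_weight A B \<gamma> t x) +
        (\<phi> \<epsilon> - B * poly p 0) * \<epsilon> powr \<gamma>"
      by (subst set_integral_add(2)[OF set_integrable_poly_shifted_weight[OF assms] d(1)])
        (auto simp: d(2) \<phi>_def)
    finally show ?thesis
      using \<epsilon> by (simp add: regularised_def powr_add left_diff_distrib)
  qed
  have "(\<phi> has_real_derivative
      A * t * poly p 0 - A * poly (pderiv p) 0 - (A + B) * (poly (pderiv p) 0 - t * poly p 0)) (at 0)"
    unfolding \<phi>_def by (auto intro!: derivative_eq_intros simp: algebra_simps)
  \<comment> \<open>The value of \<open>D\<close> is immaterial: it gets multiplied by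
    \<open>0 powr (\<gamma> + 1) = 0\<close>.\<close>
  then obtain D where "(\<phi> has_real_derivative D) (at 0)"
    by blast
  moreover have "\<phi> 0 = 0"
    by (simp add: \<phi>_def algebra_simps)
  ultimately have lim1: "((\<lambda>\<epsilon>. \<phi> \<epsilon> / \<epsilon>) \<longlongrightarrow> D) (at_right 0)"
    by (simp add: has_field_derivative_iff filterlim_at_split)
  have lim2: "((\<lambda>\<epsilon>. \<epsilon> powr (\<gamma> + 1)) \<longlongrightarrow> 0 powr (\<gamma> + 1)) (at_right (0::real))"
    using assms by (intro tendsto_powr2) (auto simp: eventually_at_filter)
  have lim3: "((\<lambda>\<epsilon>. LINT x:{x. \<epsilon> < \<bar>x\<bar>}|lborel. poly ?q x * shifted_weight A B \<gamma> t x) \<longlongrightarrow> moment A B \<gamma> t ?q) (at_right 0)"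
    unfolding moment_def by (rule tendsto_integral_outside[OF integrable_poly_shifted_weight[OF assms]])
  from tendsto_add[OF lim3 tendsto_mult[OF lim1 lim2]]
  have "((\<lambda>\<epsilon>. (LINT x:{x. \<epsilon> < \<bar>x\<bar>}|lborel. poly ?q x * shifted_weight A B \<gamma> t x)
      + \<phi> \<epsilon> / \<epsilon> * \<epsilon> powr (\<gamma> + 1)) \<longlongrightarrow> moment A B \<gamma> t ?q + D * 0 powr (\<gamma> + 1)) (at_right 0)" .
  moreover have "\<forall>\<^sub>F \<epsilon> in at_right 0. (LINT x:{x. \<epsilon> < \<bar>x\<bar>}|lborel. poly ?q x * shifted_weight A B \<gamma> t x)
      + \<phi> \<epsilon> / \<epsilon> * \<epsilon> powr (\<gamma> + 1) = regularised A B \<gamma> t p \<epsilon>"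
    using eventually_at_right_less by eventually_elim (simp only: reg)
  ultimately have "(regularised A B \<gamma> t p \<longlongrightarrow> moment A B \<gamma> t ?q + D * 0 powr (\<gamma> + 1)) (at_right 0)"
    by (rule Lim_transform_eventually)
  then show ?thesis
    using moment_add[OF assms, of A B t ?q "pderiv p"] by simp
qed

text \<open>The factor \<open>x\<close> cancels the denominator, and the compensating term is zero
  since \<open>X * p\<close> vanishes at 0.\<close>

lemma regularised_X_tendsto:
  assumes "\<gamma> > -1"
  shows "(regularised A B \<gamma> t (X * p) \<longlongrightarrow> \<gamma> * moment A B \<gamma> t p) (at_right 0)"
proof -
  have "((\<lambda>\<epsilon>. LINT x:{x. \<epsilon> < \<bar>x\<bar>}|lborel. poly p x * shifted_weight A B \<gamma> t x) \<longlongrightarrow> moment A B \<gamma> t p) (at_right 0)"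
    unfolding moment_def by (rule tendsto_integral_outside[OF integrable_poly_shifted_weight[OF assms]])
  then have "((\<lambda>\<epsilon>. \<gamma> * (LINT x:{x. \<epsilon> < \<bar>x\<bar>}|lborel. poly p x * shifted_weight A B \<gamma> t x)) \<longlongrightarrow> \<gamma> * moment A B \<gamma> t p) (at_right 0)"
    by (rule tendsto_mult_left)
  moreover have "\<forall>\<^sub>F \<epsilon> in at_right 0. \<gamma> * (LINT x:{x. \<epsilon> < \<bar>x\<bar>}|lborel. poly p x * shifted_weight A B \<gamma> t x)
      = regularised A B \<gamma> t (X * p) \<epsilon>"
    using eventually_at_right_less
  proof eventually_elim
    case (elim \<epsilon>)
    have "(LINT x:{x. \<epsilon> < \<bar>x\<bar>}|lborel. poly p x * shifted_weight A B \<gamma> t x) =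
        (LINT x:{x. \<epsilon> < \<bar>x\<bar>}|lborel. poly (X * p) x * shifted_weight A B \<gamma> t x / x)"
      by (rule set_lebesgue_integral_cong) (use elim in \<open>auto simp: poly_monom\<close>)
    then show ?case
      by (simp add: regularised_def poly_monom)
  qed
  ultimately show ?thesis
    by (rule Lim_transform_eventually)
qed

section \<open>Return to the original variable and the Riccati equations\<close>

lemma singular_integral_eq_regularised:
  "singular_integral A B \<gamma> t (poly p) = Lim (at_right 0) (regularised A B \<gamma> t (pcompose p [:t, 1:]))"
proof -
  have "(LINT y:{y. \<epsilon> < \<bar>y - t\<bar>}|lborel. poly p y * weight A B \<gamma> t y / (y - t)) =
      (LINT x:{x. \<epsilon> < \<bar>x\<bar>}|lborel. poly (pcompose p [:t, 1:]) x * shifted_weight A B \<gamma> t x / x)" for \<epsilon>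
    unfolding set_lebesgue_integral_def
    by (subst lborel_integral_real_affine[where c = 1 and t = t])
      (auto simp: weight_eq_shifted_weight poly_pcompose indicator_def)
  then show ?thesis
    by (simp add: singular_integral_def regularised_def[abs_def] poly_pcompose)
qed

lemma orthogonal_functional_shift:
  assumes "A \<ge> 0" and "A + B \<ge> 0" and "\<not> (A = 0 \<and> B = 0)" and "\<gamma> > -1"
    and P: "monic_orthogonal (weight A B \<gamma> t) P h"
  shows "orthogonal_functional (moment A B \<gamma> t) (\<lambda>n. pcompose (P n) [:t, 1:]) h"
proof
  show deg: "degree (pcompose (P i) [:t, 1:]) = i" for i
    using P by (simp add: monic_orthogonal_def degree_pcompose)
  have "lead_coeff (pcompose (P i) [:t, 1:]) = 1" for i
    using P by (subst lead_coeff_comp) (auto simp: monic_orthogonal_def dest: spec[of _ i])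
  then show "coeff (pcompose (P i) [:t, 1:]) (degree (pcompose (P i) [:t, 1:])) = 1" for i .
  show "moment A B \<gamma> t (p * p) = 0 \<Longrightarrow> p = 0" for p
    by (rule moment_definite[OF assms(4,1,2,3)])
  show "moment A B \<gamma> t (pcompose (P i) [:t, 1:] * pcompose (P j) [:t, 1:]) = (if i = j then h i else 0)" for i j
  proof -
    have "moment A B \<gamma> t (pcompose (P i) [:t, 1:] * pcompose (P j) [:t, 1:]) =
        (LINT z|lborel. poly (P i) z * poly (P j) z * weight A B \<gamma> t z)"
      unfolding moment_def
      by (subst (2) lborel_integral_real_affine[where c = 1 and t = t])
        (auto simp: weight_eq_shifted_weight poly_pcompose)
    then show ?thesis
      using P by (auto simp: monic_orthogonal_def)
  qed
qed (use assms(4) in \<open>simp_all add: moment_add moment_smult\<close>)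

theorem theorem4p2:
  fixes A B \<gamma> :: real
    and P :: "real \<Rightarrow> nat \<Rightarrow> real poly"
    and h :: "real \<Rightarrow> nat \<Rightarrow> real"
    and n :: nat and t :: real
  assumes "A \<ge> 0" and "A + B \<ge> 0" and "\<not> (A = 0 \<and> B = 0)" and "\<gamma> > -1"
    and "\<forall>s. monic_orthogonal (weight A B \<gamma> s) (P s) (h s)"
  shows "let R = R_aux A B \<gamma> P h n; r = r_aux A B \<gamma> P h n in
      (R t \<noteq> 0 \<longrightarrow>
        (r has_real_derivative
          ((r t)\<^sup>2 - \<gamma> * r t) / R t - (r t + real n) * R t / 2) (at t)) \<and>
      (R has_real_derivative
        2 * r t - 1 / 2 * (t - R t) * R t - \<gamma>) (at t)"
proof -
  define Q where "Q s k = pcompose (P s k) [:s, 1:]" for s k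
  define S where "S s p = Lim (at_right 0) (regularised A B \<gamma> s p)" for s p
  have orthogonal_Q: "orthogonal_functional (moment A B \<gamma> s) (Q s) (h s)" for s
    using orthogonal_functional_shift[OF assms(1-4)] assms(5) unfolding Q_def by blast
  interpret toda_family "moment A B \<gamma>" Q h
    by (intro toda_family.intro orthogonal_Q moment_has_derivative assms)
  interpret S: semiclassical_functional "moment A B \<gamma> s" "Q s" "h s" "S s" s \<gamma> for s
  proof (intro semiclassical_functional.intro semiclassical_functional_axioms.intro)
    show "S s p = moment A B \<gamma> s ([:s, 2:] * p) - moment A B \<gamma> s (pderiv p)" for p
      unfolding S_def by (rule tendsto_Lim[OF _ regularised_tendsto[OF assms(4)]]) simp
    show "S s (X * p) = \<gamma> * moment A B \<gamma> s p" for p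
      unfolding S_def by (rule tendsto_Lim[OF _ regularised_X_tendsto[OF assms(4)]]) simp
  qed (rule orthogonal_Q)
  have R: "R_aux A B \<gamma> P h n = (\<lambda>s. 2 * \<alpha> s n + s)"
  proof
    fix s
    have "singular_integral A B \<gamma> s (\<lambda>y. (poly (P s n) y)\<^sup>2) = S s (Q s n * Q s n)"
      using singular_integral_eq_regularised[of A B \<gamma> s "P s n * P s n"]
      by (simp add: S_def Q_def pcompose_mult power2_eq_square poly_mult[abs_def])
    then show "R_aux A B \<gamma> P h n s = 2 * \<alpha> s n + s"
      by (simp add: R_aux_def S.S_Q_Q)
  qed
  have r: "r_aux A B \<gamma> P h n = (\<lambda>s. 2 * \<beta> s n - n)"
  proof
    fix s
    have "singular_integral A B \<gamma> s (\<lambda>y. poly (P s n) y * poly (P s (n - 1)) y) = S s (Q s n * Q s (n - 1))"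
      using singular_integral_eq_regularised[of A B \<gamma> s "P s n * P s (n - 1)"]
      by (simp add: S_def Q_def pcompose_mult poly_mult[abs_def])
    \<comment> \<open>At \<open>n = 0\<close> the convention \<open>r_aux = 0\<close> agrees with
      \<open>\<beta> s 0 = 0\<close>.\<close>
    then show "r_aux A B \<gamma> P h n s = 2 * \<beta> s n - n"
      by (cases "n = 0") (simp_all add: r_aux_def S.S_Q_Q_prev[simplified])
  qed
  have "((\<lambda>s. 2 * \<alpha> s n + s) has_real_derivative
      2 * (2 * \<beta> t n - n) - 1 / 2 * (t - (2 * \<alpha> t n + t)) * (2 * \<alpha> t n + t) - \<gamma>) (at t)"
  proof (rule DERIV_cong)
    show "((\<lambda>s. 2 * \<alpha> s n + s) has_real_derivative 2 * (\<beta> t n - \<beta> t (Suc n)) + 1) (at t)"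
      by (intro derivative_intros DERIV_cmult toda_equations)
    \<comment> \<open>The string equation eliminates \<open>\<beta> t (Suc n)\<close>.\<close>
    show "2 * (\<beta> t n - \<beta> t (Suc n)) + 1 =
        2 * (2 * \<beta> t n - n) - 1 / 2 * (t - (2 * \<alpha> t n + t)) * (2 * \<alpha> t n + t) - \<gamma>"
      using S.string_equation[of t n] by (simp add: algebra_simps)
  qed
  moreover have "((\<lambda>s. 2 * \<beta> s n - n) has_real_derivative
      ((2 * \<beta> t n - n)\<^sup>2 - \<gamma> * (2 * \<beta> t n - n)) / (2 * \<alpha> t n + t)
      - (2 * \<beta> t n - n + n) * (2 * \<alpha> t n + t) / 2) (at t)" if nz: "2 * \<alpha> t n + t \<noteq> 0"
  proof (rule DERIV_cong)
    show "((\<lambda>s. 2 * \<beta> s n - n) has_real_derivative 2 * (\<beta> t n * (\<alpha> t (n - 1) - \<alpha> t n)) - 0) (at t)"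
      by (intro derivative_intros DERIV_cmult toda_equations)
    \<comment> \<open>The quadratic relation eliminates the index \<open>n - 1\<close> from the Toda
      equation for \<open>\<beta>\<close>; at \<open>n = 0\<close> both sides are 0.\<close>
    have "(2 * \<beta> t n - n)\<^sup>2 - \<gamma> * (2 * \<beta> t n - n) = \<beta> t n * (2 * \<alpha> t (n - 1) + t) * (2 * \<alpha> t n + t)"
    proof (cases "n = 0")
      case False
      from S.quadratic_relation[OF this, of t] show ?thesis
        by (simp add: power2_eq_square algebra_simps)
    qed simp
    then have "((2 * \<beta> t n - n)\<^sup>2 - \<gamma> * (2 * \<beta> t n - n)) / (2 * \<alpha> t n + t) = \<beta> t n * (2 * \<alpha> t (n - 1) + t)"
      by (simp only: nonzero_mult_div_cancel_right[OF nz])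
    then show "2 * (\<beta> t n * (\<alpha> t (n - 1) - \<alpha> t n)) - 0 =
        ((2 * \<beta> t n - n)\<^sup>2 - \<gamma> * (2 * \<beta> t n - n)) / (2 * \<alpha> t n + t)
        - (2 * \<beta> t n - n + n) * (2 * \<alpha> t n + t) / 2"
      by (simp only:) (simp add: algebra_simps)
  qed
  ultimately show ?thesis
    unfolding Let_def R r by blast
qed

end
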